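(* Let $b_0,b_1,b_2,\dots$ be i.i.d. random variables with $P(b_n=1)=P(b_n=0)=P(b_n=-1)=1/3$. For each odd positive integer $p$, let $X_0=0$ and $X_{n+1}=2X_n+b_n \pmod p$ for $n\ge 0$, and let $P_n=P_n^{(p)}$ be the distribution of $X_n$ on $\mathbb{Z}/p\mathbb{Z}$, i.e. $P_n(s)=P(X_n=s)$ for $s\in\mathbb{Z}/p\mathbb{Z}$. Let $U$ be the uniform distribution on $\mathbb{Z}/p\mathbb{Z}$. Then there exists a constant $c_1>1$ such that, for every function $p\mapsto n(p)$ from odd positive integers to nonnegative integers with $n(p)<c_1\log_2 p$, one has $\|P_{n(p)}-U\|\to 1$ as $p\to\infty$ through odd integers.
   Context: For a probability $P$ on $\mathbb{Z}/p\mathbb{Z}$, the variation distance from the uniform distribution $U$ is $$\|P-U\|=\frac12\sum_{s\in\mathbb{Z}/p\mathbb{Z}}\left|P(s)-\frac1p\right|=\max_{A\subseteq\mathbb{Z}/p\mathbb{Z}}|P(A)-U(A)|.$$ *)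

theory Defs
  imports "HOL-Probability.Probability"
begin

text \<open>
  Z/pZ is represented by the residues \<^term>\<open>{0..<int p}\<close>.
\<close>

primrec chung_chain :: "nat \<Rightarrow> (nat \<Rightarrow> 'a \<Rightarrow> int) \<Rightarrow> nat \<Rightarrow> 'a \<Rightarrow> int" where
  "chung_chain p b 0 = (\<lambda>\<omega>. 0)"
| "chung_chain p b (Suc n) = (\<lambda>\<omega>. (2 * chung_chain p b n \<omega> + b n \<omega>) mod int p)"

definition chain_law :: "'a measure \<Rightarrow> (nat \<Rightarrow> 'a \<Rightarrow> int) \<Rightarrow> nat \<Rightarrow> nat \<Rightarrow> int measure" where
  "chain_law M b p n = distr M (count_space {0..<int p}) (chung_chain p b n)"

definition var_dist :: "'s set \<Rightarrow> 's measure \<Rightarrow> 's measure \<Rightarrow> real" where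
  "var_dist S P Q = 1 / 2 * (\<Sum>s\<in>S. \<bar>measure P {s} - measure Q {s}\<bar>)"

definition unif_dist :: "nat \<Rightarrow> int measure \<Rightarrow> real" where
  "unif_dist p P = var_dist {0..<int p} P (uniform_count_measure {0..<int p})"

end

theory Submission
  imports Defs "HOL-Real_Asymp.Real_Asymp"
begin

text \<open>
  Lift the walk to the integers, where \<open>Y\<^sub>n\<^sub>+\<^sub>1 = 2 Y\<^sub>n + b\<^sub>n\<close> takes fewer than \<open>2\<^sup>n\<^sup>+\<^sup>1\<close> values.
  The two's complement binary digits of \<open>Y\<^sub>n\<close> are biased: in the long run adjacent digits differ
  with frequency \<open>5/9\<close> instead of \<open>1/2\<close>. Exponential moments of the number of digit changes
  therefore confine \<open>Y\<^sub>n\<close>, up to exponentially small probability, to a set of size at most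
  \<open>2 \<theta>\<^sup>n\<close> with \<open>\<theta> < 2\<close>. For \<open>n < c\<^sub>1 log\<^sub>2 p\<close> with \<open>c\<^sub>1 log\<^sub>2 \<theta> < 1\<close> this set has \<open>o(p)\<close> elements.
\<close>

section \<open>Digit changes of integers\<close>

text \<open>Parity is the lowest two's complement digit and \<open>y div 2\<close> deletes it. The
  recursion stops at the fixed points 0 and -1 of \<open>y div 2\<close>, whose expansions are
  constant.\<close>

function digit_changes :: "int \<Rightarrow> nat" where
  "digit_changes y = (if y = 0 \<or> y = -1 then 0
     else digit_changes (y div 2) + of_bool (even y \<noteq> even (y div 2)))"
  by pat_completeness auto
termination by (relation "Wellfounded.measure (\<lambda>y. nat \<bar>y\<bar>)") auto

declare digit_changes.simps [simp del]

lemma digit_changes_0 [simp]: "digit_changes 0 = 0"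
  and digit_changes_minus_1 [simp]: "digit_changes (-1) = 0"
  by (simp_all add: digit_changes.simps)

lemma digit_changes_double: "digit_changes (2 * y) = digit_changes y + of_bool (odd y)"
proof (cases "y = 0")
  case False
  then show ?thesis by (subst digit_changes.simps) auto
qed simp

lemma digit_changes_double_plus_1:
  "digit_changes (2 * y + 1) = digit_changes y + of_bool (even y)"
proof (cases "y = -1")
  case False
  then have "2 * y + 1 \<noteq> 0" "2 * y + 1 \<noteq> -1" by presburger+
  then show ?thesis by (subst digit_changes.simps) auto
qed simp

text \<open>Induction on appended digits: of the two digits that can follow \<open>y\<close>,
  exactly one creates a change, so each step multiplies the sum by \<open>1 + x\<close>. The factor
  2 comes from the starting values 0 and -1.\<close>

lemma sum_power_digit_changes:
  fixes x :: real
  shows "(\<Sum>y\<in>{-(2^n)..<2^n}. x ^ digit_changes y) = 2 * (1 + x) ^ n"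
proof (induction n)
  case 0
  have "{-1..<1::int} = {-1, 0}" by auto
  then show ?case by simp
next
  case (Suc n)
  let ?I = "{-(2^n)..<2^n::int}"
  have split: "{-(2^Suc n)..<2^Suc n::int} = (\<lambda>y. 2 * y) ` ?I \<union> (\<lambda>y. 2 * y + 1) ` ?I"
  proof (intro equalityI subsetI)
    fix z :: int assume z: "z \<in> {-(2^Suc n)..<2^Suc n}"
    then have "z div 2 \<in> ?I" by auto
    moreover have "z = 2 * (z div 2) \<or> z = 2 * (z div 2) + 1" by presburger
    ultimately show "z \<in> (\<lambda>y. 2 * y) ` ?I \<union> (\<lambda>y. 2 * y + 1) ` ?I" by blast
  qed auto
  have disj: "(\<lambda>y. 2 * y) ` ?I \<inter> (\<lambda>y. 2 * y + 1) ` ?I = {}"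
    by (auto; presburger)
  have "(\<Sum>y\<in>{-(2^Suc n)..<2^Suc n}. x ^ digit_changes y) =
      (\<Sum>y\<in>?I. x ^ digit_changes (2 * y)) + (\<Sum>y\<in>?I. x ^ digit_changes (2 * y + 1))"
    unfolding split by (subst sum.union_disjoint[OF _ _ disj]) (auto simp: sum.reindex inj_on_def)
  also have "\<dots> = (\<Sum>y\<in>?I. (1 + x) * x ^ digit_changes y)"
    unfolding sum.distrib[symmetric]
    by (intro sum.cong refl)
       (simp add: digit_changes_double digit_changes_double_plus_1 distrib_right)
  also have "\<dots> = 2 * (1 + x) ^ Suc n"
    by (simp add: Suc flip: sum_distrib_left)
  finally show ?case .
qed

section \<open>A Lyapunov function for one step of the walk\<close>

text \<open>
  Since \<open>2 y - 1\<close> is \<open>y - 1\<close> with the digit 1 appended, one step of the walk involves both \<open>y\<close> and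
  \<open>y - 1\<close>. The parity weights approximate the Perron eigenvector of the resulting transfer matrix.
\<close>

definition lyapunov :: "int \<Rightarrow> real" where
  "lyapunov y = (if even y then 28 else 27) *
     ((9/10) ^ digit_changes y + (9/10) ^ digit_changes (y - 1))"

lemma lyapunov_nonneg: "0 \<le> lyapunov y"
  by (simp add: lyapunov_def)

lemma lyapunov_le: "lyapunov y \<le> 56"
proof -
  have *: "(9/10 :: real) ^ k \<le> 1" for k by (simp add: power_le_one)
  show ?thesis
    using *[of "digit_changes y"] *[of "digit_changes (y - 1)"] by (auto simp: lyapunov_def)
qed

lemma power_digit_changes_le_lyapunov: "(9/10) ^ digit_changes y \<le> lyapunov y"
proof -
  have *: "0 \<le> (9/10 :: real) ^ k" for k by simp
  show ?thesis
    using *[of "digit_changes y"] *[of "digit_changes (y - 1)"] unfolding lyapunov_def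
    by auto
qed

text \<open>With \<open>A\<close> and \<open>B\<close> as in the proof, the left side equals 79.3 (A
  + B) for even \<open>y\<close> and 76.5 (A + B) for odd \<open>y\<close>; the right side is 79.38
  (A + B) and 76.545 (A + B). The factor 3 is the number of digit values to average over.\<close>

lemma lyapunov_step:
  "lyapunov (2 * y - 1) + lyapunov (2 * y) + lyapunov (2 * y + 1) \<le> 3 * (945/1000) * lyapunov y"
proof -
  have eq: "2 * y - 1 = 2 * (y - 1) + 1" "2 * y - 1 - 1 = 2 * (y - 1)" "2 * y + 1 - 1 = 2 * y"
    by simp_all
  define A B :: real where "A = (9/10) ^ digit_changes y" and "B = (9/10) ^ digit_changes (y - 1)"
  have AB: "0 \<le> A" "0 \<le> B" by (simp_all add: A_def B_def)
  have pow: "(9/10 :: real) ^ digit_changes (2 * y) = A * (if even y then 1 else 9/10)"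
    "(9/10 :: real) ^ digit_changes (2 * y + 1) = A * (if even y then 9/10 else 1)"
    "(9/10 :: real) ^ digit_changes (2 * (y - 1) + 1) = B * (if even y then 1 else 9/10)"
    "(9/10 :: real) ^ digit_changes (2 * (y - 1)) = B * (if even y then 9/10 else 1)"
    unfolding digit_changes_double digit_changes_double_plus_1 by (simp_all add: A_def B_def)
  show ?thesis
    using AB unfolding lyapunov_def eq(2,3) unfolding eq(1) pow A_def[symmetric] B_def[symmetric]
    by (cases "even y") (simp_all add: algebra_simps)
qed

text \<open>
  The threshold rate \<open>0.946\<close> exceeds the contraction rate \<open>0.945\<close> of the previous lemma, and
  \<open>0.946 * (1 + 10/9) = 17974/9000 < 2\<close>.
\<close>

lemma card_lyapunov_less:
  "real (card {y \<in> {-(2^n)..<2^n}. lyapunov y < (946/1000) ^ n}) \<le> 2 * (17974/9000) ^ n"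
proof -
  let ?A = "{y \<in> {-(2^n)..<2^n}. lyapunov y < (946/1000) ^ n}"
  \<comment> \<open>Counting by an exponential weight: a small Lyapunov value forces many digit
    changes, so every counted element has weight at least 1.\<close>
  have ge: "1 \<le> (946/1000) ^ n * (10/9 :: real) ^ digit_changes y" if "y \<in> ?A" for y
  proof -
    have "(9/10) ^ digit_changes y \<le> (946/1000 :: real) ^ n"
      using that power_digit_changes_le_lyapunov[of y] by simp
    then have "(9/10) ^ digit_changes y * (10/9) ^ digit_changes y
        \<le> (946/1000 :: real) ^ n * (10/9) ^ digit_changes y"
      by (intro mult_right_mono) auto
    then show ?thesis by (simp flip: power_mult_distrib)
  qed
  have "real (card ?A) = (\<Sum>y\<in>?A. 1)" by simp
  also have "\<dots> \<le> (\<Sum>y\<in>?A. (946/1000) ^ n * (10/9) ^ digit_changes y)"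
    by (intro sum_mono ge)
  also have "\<dots> \<le> (\<Sum>y\<in>{-(2^n)..<2^n}. (946/1000) ^ n * (10/9) ^ digit_changes y)"
    by (intro sum_mono2) auto
  also have "\<dots> = (946/1000) ^ n * (2 * (1 + 10/9) ^ n)"
    by (simp only: sum_distrib_left[symmetric] sum_power_digit_changes)
  also have "\<dots> = 2 * (17974/9000) ^ n"
    by (simp flip: power_mult_distrib)
  finally show ?thesis .
qed

section \<open>Variation distance\<close>

text \<open>The differences sum to zero over \<open>S\<close>, so their sum over \<open>A\<close> is
  matched by its negative over \<open>S - A\<close>. Each contributes at least that much to the sum
  of absolute values, and the factor 1/2 compensates.\<close>

lemma var_dist_ge:
  assumes "finite S" "A \<subseteq> S"
    and "(\<Sum>s\<in>S. measure P {s}) = 1" "(\<Sum>s\<in>S. measure Q {s}) = 1"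
  shows "(\<Sum>s\<in>A. measure P {s}) - (\<Sum>s\<in>A. measure Q {s}) \<le> var_dist S P Q"
proof -
  let ?d = "\<lambda>s. measure P {s} - measure Q {s}"
  have split: "sum f S = sum f A + sum f (S - A)" for f :: "_ \<Rightarrow> real"
    using assms(1,2) by (metis add.commute sum.subset_diff)
  have "sum ?d A + sum ?d (S - A) = 0"
    unfolding split[of ?d, symmetric] using assms(3,4) by (simp add: sum_subtractf)
  moreover have "sum ?d A \<le> (\<Sum>s\<in>A. \<bar>?d s\<bar>)" "- sum ?d (S - A) \<le> (\<Sum>s\<in>S - A. \<bar>?d s\<bar>)"
    by (intro sum_mono | simp flip: sum_negf)+
  ultimately show ?thesis
    unfolding var_dist_def split[of "\<lambda>s. \<bar>?d s\<bar>"] by (simp add: sum_subtractf)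
qed

lemma var_dist_le_1:
  assumes "(\<Sum>s\<in>S. measure P {s}) = 1" "(\<Sum>s\<in>S. measure Q {s}) = 1"
  shows "var_dist S P Q \<le> 1"
proof -
  have "(\<Sum>s\<in>S. \<bar>measure P {s} - measure Q {s}\<bar>) \<le> (\<Sum>s\<in>S. measure P {s} + measure Q {s})"
    by (intro sum_mono) (smt (verit) measure_nonneg)
  then show ?thesis using assms by (simp add: var_dist_def sum.distrib)
qed

section \<open>The lifted walk\<close>

text \<open>The lift of the walk to the integers is \<^term>\<open>chung_chain 0\<close>, because \<open>x mod 0 = x\<close>.\<close>

lemma chung_chain_eq_mod: "chung_chain p b n \<omega> = chung_chain 0 b n \<omega> mod int p"
  by (induction n) (simp_all, metis mod_add_left_eq mod_mult_right_eq)

text \<open>Only digits below \<open>n\<close> are constrained, so that the result also applies to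
  the coordinate maps of a product over \<open>{..<n}\<close>.\<close>

lemma measurable_chung_chain:
  assumes "\<And>i. i < n \<Longrightarrow> b i \<in> measurable M (count_space UNIV)"
  shows "chung_chain p b n \<in> measurable M (count_space UNIV)"
  using assms
proof (induction n)
  case (Suc n)
  then have "chung_chain p b n \<in> measurable M (count_space UNIV)"
    "b n \<in> measurable M (count_space UNIV)" by simp_all
  then show ?case by simp
qed simp

lemma chung_chain_cong:
  "(\<And>i. i < n \<Longrightarrow> b i \<omega> = b' i \<omega>') \<Longrightarrow> chung_chain p b n \<omega> = chung_chain p b' n \<omega>'"
  by (induction n) auto

locale ternary_digits = prob_space M for M :: "'a measure" +
  fixes b :: "nat \<Rightarrow> 'a \<Rightarrow> int"
  assumes indep: "indep_vars (\<lambda>_. count_space UNIV) b UNIV"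
    and prob_1: "\<And>n. prob {\<omega> \<in> space M. b n \<omega> = 1} = 1 / 3"
    and prob_0: "\<And>n. prob {\<omega> \<in> space M. b n \<omega> = 0} = 1 / 3"
    and prob_minus_1: "\<And>n. prob {\<omega> \<in> space M. b n \<omega> = -1} = 1 / 3"
begin

lemma measurable_digit [measurable]: "b n \<in> measurable M (count_space UNIV)"
  using indep by (auto simp: indep_vars_def)

lemma measurable_chain [measurable]: "chung_chain p b n \<in> measurable M (count_space UNIV)"
  by (intro measurable_chung_chain measurable_digit)

lemma AE_digit: "AE \<omega> in M. b n \<omega> \<in> {-1, 0, 1}"
proof -
  let ?D = "\<lambda>d. {\<omega> \<in> space M. b n \<omega> = d}"
  have "prob (?D 1 \<union> (?D 0 \<union> ?D (-1))) = prob (?D 1) + prob (?D 0 \<union> ?D (-1))"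
    by (intro finite_measure_Union) auto
  also have "prob (?D 0 \<union> ?D (-1)) = prob (?D 0) + prob (?D (-1))"
    by (intro finite_measure_Union) auto
  finally have "prob (?D 1 \<union> (?D 0 \<union> ?D (-1))) = 1"
    by (simp add: prob_0 prob_1 prob_minus_1)
  then have "AE \<omega> in M. \<omega> \<in> ?D 1 \<union> (?D 0 \<union> ?D (-1))"
    by (subst prob_eq_1[symmetric]) auto
  then show ?thesis by eventually_elim auto
qed

lemma AE_chain_bounds: "AE \<omega> in M. chung_chain 0 b n \<omega> \<in> {-(2^n)..<2^n}"
proof -
  have "AE \<omega> in M. \<forall>i. b i \<omega> \<in> {-1, 0, 1}"
    using AE_digit by (simp add: AE_all_countable)
  then show ?thesis
  proof eventually_elim
    case (elim \<omega>)
    \<comment> \<open>For integers, strictness is what carries the induction: from a bound of 2^n -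
      1 in absolute value, doubling and adding a digit gives at most 2^(n+1) - 1.\<close>
    have "\<bar>chung_chain 0 b n \<omega>\<bar> < 2^n"
    proof (induction n)
      case (Suc n)
      have "\<bar>b n \<omega>\<bar> \<le> 1" using elim[rule_format, of n] by auto
      then show ?case using Suc by simp
    qed simp
    then show ?case by auto
  qed
qed

text \<open>The position at time \<open>n\<close> is a function of the digits with index below
  \<open>n\<close>, and \<open>{..<n}\<close> is disjoint from \<open>{n}\<close>.\<close>

lemma indep_chain_digit:
  "indep_var (count_space UNIV) (chung_chain 0 b n) (count_space UNIV) (b n)"
proof -
  let ?N = "\<lambda>A. PiM A (\<lambda>_::nat. count_space (UNIV :: int set))"
  have "indep_var (?N {..<n}) (\<lambda>\<omega>. restrict (\<lambda>i. b i \<omega>) {..<n})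
      (?N {n}) (\<lambda>\<omega>. restrict (\<lambda>i. b i \<omega>) {n})"
    by (rule indep_var_restrict[OF indep]) auto
  then have "indep_var (count_space UNIV)
      (chung_chain 0 (\<lambda>i x. x i) n \<circ> (\<lambda>\<omega>. restrict (\<lambda>i. b i \<omega>) {..<n}))
      (count_space UNIV) ((\<lambda>x. x n) \<circ> (\<lambda>\<omega>. restrict (\<lambda>i. b i \<omega>) {n}))"
    by (rule indep_var_compose)
       (auto intro!: measurable_chung_chain measurable_component_singleton)
  moreover have "chung_chain 0 (\<lambda>i x. x i) n \<circ> (\<lambda>\<omega>. restrict (\<lambda>i. b i \<omega>) {..<n}) = chung_chain 0 b n"
    by (rule ext) (auto intro!: chung_chain_cong)
  moreover have "(\<lambda>x. x n) \<circ> (\<lambda>\<omega>. restrict (\<lambda>i. b i \<omega>) {n}) = b n"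
    by (rule ext) simp
  ultimately show ?thesis by simp
qed

lemma integrable_bounded:
  fixes f :: "int \<Rightarrow> real"
  assumes "\<And>y. \<bar>f y\<bar> \<le> C" "Y \<in> measurable M (count_space UNIV)"
  shows "integrable M (\<lambda>\<omega>. f (Y \<omega>))"
  using assms by (intro integrable_const_bound[where B = C]) auto

text \<open>Split according to the value of the last digit by indicators; independence turns each
  product into an expectation times 1/3. Boundedness supplies integrability.\<close>

lemma expectation_chain_Suc:
  fixes f :: "int \<Rightarrow> real"
  assumes bd: "\<And>y. \<bar>f y\<bar> \<le> C"
  shows "expectation (\<lambda>\<omega>. f (chung_chain 0 b (Suc n) \<omega>)) =
    expectation (\<lambda>\<omega>. f (2 * chung_chain 0 b n \<omega> - 1) + f (2 * chung_chain 0 b n \<omega>)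
      + f (2 * chung_chain 0 b n \<omega> + 1)) / 3"
proof -
  let ?Y = "chung_chain 0 b n"
  let ?g = "\<lambda>d \<omega>. f (2 * ?Y \<omega> + d)" and ?i = "\<lambda>d \<omega>. indicator {d} (b n \<omega>) :: real"
  have int_g: "integrable M (?g d)" for d
    using integrable_bounded[of "\<lambda>y. f (2 * y + d)" C "?Y"] bd by simp
  have int_i: "integrable M (?i d)" for d
    by (rule integrable_bounded[where C = 1]) (auto simp: indicator_def)
  have ind: "indep_var borel (?g d) borel (?i d)" for d
    using indep_var_compose[OF indep_chain_digit, of "\<lambda>y. f (2 * y + d)" borel "indicator {d}" borel n]
    by (simp add: o_def)
  have prob_digit: "prob {\<omega> \<in> space M. b n \<omega> = d} = 1/3" if "d \<in> {-1, 0, 1}" for d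
    using that prob_0 prob_1 prob_minus_1 by auto
  have exp_i: "expectation (?i d) = 1/3" if "d \<in> {-1, 0, 1}" for d
  proof -
    have "expectation (?i d) = expectation (indicator {\<omega> \<in> space M. b n \<omega> = d})"
      by (intro Bochner_Integration.integral_cong) (auto simp: indicator_def)
    then show ?thesis using prob_digit[OF that] by simp
  qed
  have prod: "expectation (\<lambda>\<omega>. ?g d \<omega> * ?i d \<omega>) = expectation (?g d) / 3"
    "integrable M (\<lambda>\<omega>. ?g d \<omega> * ?i d \<omega>)" if "d \<in> {-1, 0, 1}" for d
    using indep_var_lebesgue_integral[OF ind int_g int_i, of d]
      indep_var_integrable[OF ind int_g int_i, of d] exp_i[OF that] by simp_all
  have "expectation (\<lambda>\<omega>. f (chung_chain 0 b (Suc n) \<omega>)) =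
      expectation (\<lambda>\<omega>. (?g (-1) \<omega> * ?i (-1) \<omega> + ?g 0 \<omega> * ?i 0 \<omega>) + ?g 1 \<omega> * ?i 1 \<omega>)"
  proof (rule integral_cong_AE)
    show "AE \<omega> in M. f (chung_chain 0 b (Suc n) \<omega>) =
        (?g (-1) \<omega> * ?i (-1) \<omega> + ?g 0 \<omega> * ?i 0 \<omega>) + ?g 1 \<omega> * ?i 1 \<omega>"
      using AE_digit[of n] by eventually_elim auto
    show "(\<lambda>\<omega>. f (chung_chain 0 b (Suc n) \<omega>)) \<in> borel_measurable M"
      by (rule measurable_compose[OF measurable_chain]) simp
  qed (intro borel_measurable_add borel_measurable_integrable prod(2); simp)
  also have "\<dots> = (expectation (?g (-1)) + expectation (?g 0) + expectation (?g 1)) / 3"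
    using prod[of "-1"] prod[of 0] prod[of 1] by simp
  also have "\<dots> = expectation (\<lambda>\<omega>. ?g (-1) \<omega> + ?g 0 \<omega> + ?g 1 \<omega>) / 3"
    using int_g[of "-1"] int_g[of 0] int_g[of 1] by simp
  finally show ?thesis by simp
qed

section \<open>Exponential decay and concentration\<close>

lemma integrable_lyapunov:
  assumes "Y \<in> measurable M (count_space UNIV)"
  shows "integrable M (\<lambda>\<omega>. lyapunov (Y \<omega>))"
  using assms
  by (intro integrable_bounded[where C = 56]) (auto simp: lyapunov_nonneg lyapunov_le)

text \<open>Iterates \<open>lyapunov_step\<close>; the constant 56 is \<open>lyapunov 0\<close>, the
  value at the start.\<close>

lemma expectation_lyapunov: "expectation (\<lambda>\<omega>. lyapunov (chung_chain 0 b n \<omega>)) \<le> 56 * (945/1000) ^ n"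
proof (induction n)
  case (Suc n)
  let ?Y = "chung_chain 0 b n"
  have "expectation (\<lambda>\<omega>. lyapunov (chung_chain 0 b (Suc n) \<omega>)) =
      expectation (\<lambda>\<omega>. lyapunov (2 * ?Y \<omega> - 1) + lyapunov (2 * ?Y \<omega>) + lyapunov (2 * ?Y \<omega> + 1)) / 3"
    by (rule expectation_chain_Suc[where C = 56]) (simp add: lyapunov_nonneg lyapunov_le)
  also have "\<dots> \<le> expectation (\<lambda>\<omega>. 3 * (945/1000) * lyapunov (?Y \<omega>)) / 3"
    by (intro divide_right_mono integral_mono lyapunov_step Bochner_Integration.integrable_add
        integrable_mult_right integrable_lyapunov) auto
  also have "\<dots> = 945/1000 * expectation (\<lambda>\<omega>. lyapunov (?Y \<omega>))" by simp
  also have "\<dots> \<le> 945/1000 * (56 * (945/1000) ^ n)"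
    by (intro mult_left_mono Suc) auto
  finally show ?case by simp
qed (simp add: lyapunov_def prob_space)

lemma prob_lyapunov_ge:
  "prob {\<omega> \<in> space M. lyapunov (chung_chain 0 b n \<omega>) \<ge> (946/1000) ^ n} \<le> 56 * (945/946) ^ n"
proof -
  have "prob {\<omega> \<in> space M. lyapunov (chung_chain 0 b n \<omega>) \<ge> (946/1000) ^ n} \<le>
      expectation (\<lambda>\<omega>. lyapunov (chung_chain 0 b n \<omega>)) / (946/1000) ^ n"
    by (intro integral_Markov_inequality_measure[where A = "{}"] integrable_lyapunov)
       (auto simp: lyapunov_nonneg)
  also have "\<dots> \<le> 56 * (945/1000) ^ n / (946/1000) ^ n"
    by (intro divide_right_mono expectation_lyapunov) auto
  also have "\<dots> = 56 * (945/946) ^ n"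
    by (simp flip: power_divide times_divide_eq_right)
  finally show ?thesis .
qed

lemma prob_chain_typical:
  "prob {\<omega> \<in> space M. chung_chain 0 b n \<omega> \<in>
      {y \<in> {-(2^n)..<2^n}. lyapunov y < (946/1000) ^ n}} \<ge> 1 - 56 * (945/946) ^ n"
proof -
  let ?Y = "chung_chain 0 b n"
  have "prob {\<omega> \<in> space M. ?Y \<omega> \<in> {y \<in> {-(2^n)..<2^n}. lyapunov y < (946/1000) ^ n}} =
      prob {\<omega> \<in> space M. \<not> lyapunov (?Y \<omega>) \<ge> (946/1000) ^ n}"
    using AE_chain_bounds[of n] by (intro measure_eq_AE) auto
  also have "\<dots> = 1 - prob {\<omega> \<in> space M. lyapunov (?Y \<omega>) \<ge> (946/1000) ^ n}"
    by (rule prob_neg) auto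
  finally show ?thesis using prob_lyapunov_ge[of n] by simp
qed

section \<open>The law of the walk modulo p\<close>

lemma measure_chain_law:
  assumes "p > 0" "A \<subseteq> {0..<int p}"
  shows "measure (chain_law M b p n) A = prob {\<omega> \<in> space M. chung_chain p b n \<omega> \<in> A}"
proof -
  \<comment> \<open>The law lives on the counting space of the residues, so the walk must be
    measurable into that smaller space.\<close>
  have "chung_chain p b n \<omega> \<in> {0..<int p}" for \<omega>
    using assms(1) chung_chain_eq_mod[of p b n \<omega>] by simp
  then have "chung_chain p b n \<in> measurable M (count_space {0..<int p})"
    using measurable_chain[of p n] by (subst (asm) measurable_count_space_eq2_countable)
      (auto simp: measurable_count_space_eq2_countable)
  then show ?thesis
    using assms(2) unfolding chain_law_def
    by (subst measure_distr) (auto intro!: arg_cong[where f = prob])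
qed

lemma sum_measure_chain_law:
  assumes "p > 0" "A \<subseteq> {0..<int p}"
  shows "(\<Sum>s\<in>A. measure (chain_law M b p n) {s}) = prob {\<omega> \<in> space M. chung_chain p b n \<omega> \<in> A}"
proof -
  have fin: "finite A" using assms(2) finite_subset by blast
  have "(\<Sum>s\<in>A. measure (chain_law M b p n) {s}) = (\<Sum>s\<in>A. prob {\<omega> \<in> space M. chung_chain p b n \<omega> = s})"
    using assms by (intro sum.cong refl) (auto simp: measure_chain_law)
  also have "\<dots> = prob (\<Union>s\<in>A. {\<omega> \<in> space M. chung_chain p b n \<omega> = s})"
    using fin by (intro finite_measure_finite_Union[symmetric]) (auto simp: disjoint_family_on_def)
  also have "(\<Union>s\<in>A. {\<omega> \<in> space M. chung_chain p b n \<omega> = s}) = {\<omega> \<in> space M. chung_chain p b n \<omega> \<in> A}"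
    by auto
  finally show ?thesis .
qed

lemma sum_measure_chain_law_eq_1:
  assumes "p > 0"
  shows "(\<Sum>s\<in>{0..<int p}. measure (chain_law M b p n) {s}) = 1"
proof -
  have "{\<omega> \<in> space M. chung_chain p b n \<omega> \<in> {0..<int p}} = space M"
    using assms by (auto simp: chung_chain_eq_mod[of p])
  then show ?thesis
    using assms by (simp only: sum_measure_chain_law[OF assms order_refl] prob_space)
qed

lemma sum_measure_uniform:
  assumes "p > 0" "A \<subseteq> {0..<int p}"
  shows "(\<Sum>s\<in>A. measure (uniform_count_measure {0..<int p}) {s}) = real (card A) / real p"
proof -
  have "(\<Sum>s\<in>A. measure (uniform_count_measure {0..<int p}) {s}) = (\<Sum>s\<in>A. 1 / real p)"
    using assms by (intro sum.cong refl) (auto simp: measure_uniform_count_measure)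
  then show ?thesis by simp
qed

lemma sum_measure_uniform_eq_1:
  "p > 0 \<Longrightarrow> (\<Sum>s\<in>{0..<int p}. measure (uniform_count_measure {0..<int p}) {s}) = 1"
  using sum_measure_uniform[of p "{0..<int p}"] by simp

section \<open>Bounds for the distance from uniform\<close>

lemma unif_dist_le_1: "p > 0 \<Longrightarrow> unif_dist p (chain_law M b p n) \<le> 1"
  unfolding unif_dist_def
  by (intro var_dist_le_1 sum_measure_chain_law_eq_1 sum_measure_uniform_eq_1)

text \<open>Test the distance on the residues of \<open>A\<close>: reduction modulo \<open>p\<close>
  can only increase the probability of the walk and decrease the cardinality.\<close>

lemma unif_dist_ge:
  assumes "p > 0" "finite A"
  shows "unif_dist p (chain_law M b p n) \<ge>
    prob {\<omega> \<in> space M. chung_chain 0 b n \<omega> \<in> A} - real (card A) / real p"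
proof -
  let ?A = "(\<lambda>y. y mod int p) ` A"
  have sub: "?A \<subseteq> {0..<int p}" using assms by auto
  have "prob {\<omega> \<in> space M. chung_chain 0 b n \<omega> \<in> A} \<le> prob {\<omega> \<in> space M. chung_chain p b n \<omega> \<in> ?A}"
    by (intro finite_measure_mono) (auto simp: chung_chain_eq_mod[of p])
  moreover have "real (card ?A) / real p \<le> real (card A) / real p"
    using assms by (intro divide_right_mono) (auto intro: card_image_le)
  moreover have "prob {\<omega> \<in> space M. chung_chain p b n \<omega> \<in> ?A} - real (card ?A) / real p
      \<le> unif_dist p (chain_law M b p n)"
    using var_dist_ge[OF _ sub sum_measure_chain_law_eq_1 sum_measure_uniform_eq_1, of n] assms
    by (simp add: unif_dist_def sum_measure_chain_law[OF _ sub] sum_measure_uniform[OF _ sub])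
  ultimately show ?thesis by linarith
qed

lemma unif_dist_ge_range:
  assumes "p > 0"
  shows "unif_dist p (chain_law M b p n) \<ge> 1 - 2 * 2 ^ n / real p"
proof -
  have "prob {\<omega> \<in> space M. chung_chain 0 b n \<omega> \<in> {-(2^n)..<2^n}} = 1"
    using AE_chain_bounds[of n] by (subst prob_Collect_eq_1) auto
  moreover have "real (card {-(2^n)..<2^n::int}) = 2 * 2 ^ n" by simp
  ultimately show ?thesis
    using unif_dist_ge[OF assms, of "{-(2^n)..<2^n}" n] by simp
qed

lemma unif_dist_ge_typical:
  assumes "p > 0"
  shows "unif_dist p (chain_law M b p n) \<ge> 1 - 56 * (945/946) ^ n - 2 * (17974/9000) ^ n / real p"
proof -
  let ?A = "{y \<in> {-(2^n)..<2^n}. lyapunov y < (946/1000) ^ n}"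
  have "real (card ?A) / real p \<le> 2 * (17974/9000) ^ n / real p"
    by (intro divide_right_mono card_lyapunov_less) auto
  then show ?thesis
    using unif_dist_ge[OF assms, of ?A n] prob_chain_typical[of n] by fastforce
qed

text \<open>The error must depend on \<open>p\<close> alone. Up to half of log2 p steps the whole
  range of the walk is small compared with \<open>p\<close>; beyond that \<open>n\<close> is large
  enough for the exceptional probability to be small. The sum of all error terms covers both
  cases.\<close>

lemma unif_dist_ge_uniform:
  assumes "p > 1" "real n < c * log 2 (real p)"
  shows "unif_dist p (chain_law M b p n) \<ge> 1 -
    (2 * real p powr (1/2) / real p + 56 * (945/946) powr (log 2 (real p) / 2)
      + 2 * real p powr (c * log 2 (17974/9000)) / real p)"
proof (cases "real n \<le> log 2 (real p) / 2")
  case True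
  have "2 ^ n = 2 powr real n" by (simp add: powr_realpow)
  also have "\<dots> \<le> 2 powr (log 2 (real p) * (1/2))" using True by simp
  also have "\<dots> = real p powr (1/2)"
    using assms by (subst powr_powr[symmetric]) simp
  finally have "2 * 2 ^ n / real p \<le> 2 * real p powr (1/2) / real p"
    by (intro divide_right_mono mult_left_mono) auto
  moreover have "0 \<le> 56 * (945/946) powr (log 2 (real p) / 2)"
    "0 \<le> 2 * real p powr (c * log 2 (17974/9000)) / real p" by simp_all
  ultimately show ?thesis using unif_dist_ge_range[of p n] assms by linarith
next
  case False
  have "(945/946) ^ n = (945/946 :: real) powr real n" by (simp add: powr_realpow)
  also have "\<dots> \<le> (945/946) powr (log 2 (real p) / 2)"
    using False by (intro powr_mono') auto
  finally have 1: "56 * (945/946) ^ n \<le> 56 * (945/946 :: real) powr (log 2 (real p) / 2)" by simp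
  have "(17974/9000) ^ n = (17974/9000 :: real) powr real n" by (simp add: powr_realpow)
  also have "\<dots> \<le> (17974/9000) powr (c * log 2 (real p))"
    using assms by (intro powr_mono) auto
  \<comment> \<open>Exchanging base and exponent turns an exponential in log2 p into a power of
    \<open>p\<close>.\<close>
  also have "\<dots> = (2 powr log 2 (17974/9000)) powr (c * log 2 (real p))"
    by (subst powr_log_cancel) auto
  also have "\<dots> = (2 powr log 2 (real p)) powr (c * log 2 (17974/9000))"
    unfolding powr_powr by (simp add: mult_ac)
  also have "\<dots> = real p powr (c * log 2 (17974/9000))"
    using assms by simp
  finally have 2: "2 * (17974/9000) ^ n / real p
      \<le> 2 * real p powr (c * log 2 (17974/9000)) / real p"
    by (intro divide_right_mono mult_left_mono) auto
  have "0 \<le> 2 * real p powr (1/2) / real p" by simp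
  with 1 2 show ?thesis using unif_dist_ge_typical[of p n] assms by linarith
qed

end

theorem theorem1:
  fixes M :: "'a measure" and b :: "nat \<Rightarrow> 'a \<Rightarrow> int"
  assumes "prob_space M"
    and "prob_space.indep_vars M (\<lambda>_. count_space UNIV) b UNIV"
    and "\<And>n. measure M {\<omega> \<in> space M. b n \<omega> = 1} = 1 / 3"
    and "\<And>n. measure M {\<omega> \<in> space M. b n \<omega> = 0} = 1 / 3"
    and "\<And>n. measure M {\<omega> \<in> space M. b n \<omega> = -1} = 1 / 3"
  shows "\<exists>c1::real. c1 > 1 \<and>
    (\<forall>n :: nat \<Rightarrow> nat. (\<forall>p. odd p \<and> p > 1 \<longrightarrow> real (n p) < c1 * log 2 (real p)) \<longrightarrow>
      ((\<lambda>p. unif_dist p (chain_law M b p (n p))) \<longlongrightarrow> 1) (inf at_top (principal {p. odd p})))"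
proof -
  interpret ternary_digits M b
    using assms by (simp add: ternary_digits_def ternary_digits_axioms_def)
  define h :: real where "h = log 2 (17974/9000)"
  \<comment> \<open>The midpoint of 1 and \<open>1 / h\<close>: it exceeds 1 because
    \<open>h < 1\<close>, and \<open>c * h = (1 + h) / 2 < 1\<close> makes the last error term
    vanish.\<close>
  define c :: real where "c = (1 + 1 / h) / 2"
  have h: "0 < h" "h < 1"
    unfolding h_def by simp_all
  have c: "c > 1" "c * h < 1"
    using h by (simp_all add: c_def field_simps)
  define err :: "nat \<Rightarrow> real" where "err = (\<lambda>p. 2 * real p powr (1/2) / real p
    + 56 * (945/946) powr (log 2 (real p) / 2) + 2 * real p powr (c * h) / real p)"
  have "(\<lambda>p. 2 * real p powr (1/2) / real p) \<longlonglongrightarrow> 0" by real_asymp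
  moreover have "(\<lambda>p. 56 * (945/946) powr (log 2 (real p) / 2)) \<longlonglongrightarrow> 0"
  proof -
    \<comment> \<open>Naming the decay rate lets \<open>real_asymp\<close> treat it as a positive
      parameter.\<close>
    define k :: real where "k = - ln (945/946)"
    have "k > 0" by (simp add: k_def)
    then have "(\<lambda>p. 56 * exp (- k * (ln (real p) / ln 2 / 2))) \<longlonglongrightarrow> 0" by real_asymp
    then show ?thesis by (simp add: k_def powr_def log_def mult_ac)
  qed
  moreover have "(\<lambda>p. 2 * real p powr (c * h) / real p) \<longlonglongrightarrow> 0" using c(2) by real_asymp
  ultimately have "err \<longlonglongrightarrow> 0 + 0 + 0" unfolding err_def by (intro tendsto_add)
  then have err: "(\<lambda>p. 1 - err p) \<longlonglongrightarrow> 1" by (auto intro!: tendsto_eq_intros)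
  have "((\<lambda>p. unif_dist p (chain_law M b p (n p))) \<longlongrightarrow> 1) (inf at_top (principal {p. odd p}))"
    if n: "\<forall>p. odd p \<and> p > 1 \<longrightarrow> real (n p) < c * log 2 (real p)" for n
  proof (rule tendsto_sandwich)
    show "\<forall>\<^sub>F p in inf at_top (principal {p. odd p}). 1 - err p \<le> unif_dist p (chain_law M b p (n p))"
      unfolding eventually_inf_principal using eventually_gt_at_top[of 1]
      by eventually_elim (use n unif_dist_ge_uniform in \<open>auto simp: err_def h_def\<close>)
    show "\<forall>\<^sub>F p in inf at_top (principal {p. odd p}). unif_dist p (chain_law M b p (n p)) \<le> 1"
      unfolding eventually_inf_principal using eventually_gt_at_top[of 1]
      by eventually_elim (auto intro!: unif_dist_le_1)
    show "((\<lambda>p. 1 - err p) \<longlongrightarrow> 1) (inf at_top (principal {p. odd p}))"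
      using err by (rule tendsto_mono[OF inf_le1])
  qed simp
  with c(1) show ?thesis by blast
qed

end
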